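(* Let $N$ be a positive integer, let $\alpha,\beta$ be real parameters, and let $a_0,a_1,\dots,a_{N-1}$ be nonzero real constants, with $a_{-1}=a_N=0$. Let $\mathcal V_N$ be an $(N+1)$-dimensional vector space with basis $\{|n\rangle\}_{n=0}^N$. Define linear operators $Z,X,V$ on $\mathcal V_N$ by, for $n=0,1,\dots,N$, \begin{align*} Z|n\rangle &= -|n\rangle + a_n|n+1\rangle,\\ X|n\rangle &= -[\alpha-n]_q|n\rangle + a_n[\beta-n]_q|n+1\rangle,\\ V|n\rangle &= [n-\beta]_q[\beta-n+1]_q|n\rangle - \frac{q^{\alpha-N}[n]_q[N+1-n]_q}{a_{n-1}}|n-1\rangle, \end{align*} where the $|n+1\rangle$ terms are absent for $n=N$ and the $|n-1\rangle$ term is absent for $n=0$. Then these operators define a representation on $\mathcal V_N$ of the meta $q$-Hahn algebra with parameters $$\xi=q^{\alpha+1}[-\beta-1]_q[\beta-N]_q,\qquad \eta=q[\alpha]_q+[\alpha-N]_q,$$ that is, with $I$ the identity operator, \begin{align*} &[Z,X]_q=Z^2+Z-(1-q)X,\\ &[X,V]_q=\{V,Z\}+V+\xi I,\\ &[V,Z]_q=(1+q)X-(1-q)V+\eta I. \end{align*}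
   Context: $q$ is a real number with $q>0$, $q\neq 1$. Notation: $[A,B]_q=AB-qBA$, $\{A,B\}=AB+BA$, $[x]_q=\frac{1-q^x}{1-q}$. The meta $q$-Hahn algebra is the associative algebra with unit $I$, generators $X,V,Z$ and central parameters $\xi,\eta$, with defining relations $[Z,X]_q=Z^2+Z-(1-q)X$, $[X,V]_q=\{V,Z\}+V+\xi I$, $[V,Z]_q=(1+q)X-(1-q)V+\eta I$. *)

theory Defs
  imports Complex_Main
begin

definition q_number :: "real \<Rightarrow> real \<Rightarrow> real" where
  "q_number q x = (1 - q powr x) / (1 - q)"

definition basis_upto :: "nat \<Rightarrow> (nat \<Rightarrow> 'v::real_vector) \<Rightarrow> bool" where
  "basis_upto N e \<longleftrightarrow>
     inj_on e {0..N} \<and> independent (e ` {0..N}) \<and> span (e ` {0..N}) = UNIV"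

definition q_commutator ::
    "real \<Rightarrow> ('v::real_vector \<Rightarrow> 'v) \<Rightarrow> ('v \<Rightarrow> 'v) \<Rightarrow> 'v \<Rightarrow> 'v" where
  "q_commutator q A B = (\<lambda>v. A (B v) - q *\<^sub>R B (A v))"

definition anticommutator ::
    "('v::real_vector \<Rightarrow> 'v) \<Rightarrow> ('v \<Rightarrow> 'v) \<Rightarrow> 'v \<Rightarrow> 'v" where
  "anticommutator A B = (\<lambda>v. A (B v) + B (A v))"

(* The algebra is given by generators and relations, so a representation on 'v is a triple of
   linear operators on 'v satisfying the relations, with the product of the algebra read as
   composition, its unit as id, and the central parameters xi, eta acting as real scalars. *)
definition meta_q_Hahn_representation ::
    "real \<Rightarrow> real \<Rightarrow> real \<Rightarrow> ('v::real_vector \<Rightarrow> 'v) \<Rightarrow> ('v \<Rightarrow> 'v) \<Rightarrow> ('v \<Rightarrow> 'v) \<Rightarrow> bool" where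
  "meta_q_Hahn_representation q \<xi> \<eta> X V Z \<longleftrightarrow>
     linear X \<and> linear V \<and> linear Z \<and>
     q_commutator q Z X = (\<lambda>v. (Z ^^ 2) v + Z v - (1 - q) *\<^sub>R X v) \<and>
     q_commutator q X V = (\<lambda>v. anticommutator V Z v + V v + \<xi> *\<^sub>R id v) \<and>
     q_commutator q V Z = (\<lambda>v. (1 + q) *\<^sub>R X v - (1 - q) *\<^sub>R V v + \<eta> *\<^sub>R id v)"

end

theory Submission
  imports Defs
begin

text \<open>On a basis vector, every monomial of the relations is a combination of at most three
  neighbouring basis vectors, so each relation amounts to a few scalar identities. With
  \<open>q powr \<alpha>\<close>, \<open>q powr \<beta>\<close>, \<open>q powr N\<close> and \<open>q powr n\<close> as independent variables, these are
  identities of rational functions.\<close>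

context
  fixes q :: real
  assumes q: "q > 0" "q \<noteq> 1"
begin

lemma q_number_zero [simp]: "q_number q 0 = 0"
  using q by (simp add: q_number_def)

lemma q_number_plus_one: "q_number q (x + 1) = 1 + q * q_number q x"
  using q by (simp add: q_number_def powr_add field_simps)

lemma q_powr_pos: "q powr x > 0"
  using q by simp

text \<open>Coefficient of \<open>e n\<close> in the relation for the q-commutator of
  \<open>V\<close> and \<open>Z\<close>, at \<open>x = n\<close>. On the left the terms in
  \<open>q powr x\<close> cancel; the constant terms and those in \<open>q powr (- x)\<close> agree
  with the right-hand side, which forces the value of \<eta>.\<close>

lemma Z_V_diag_identity:
  "q * (q powr (\<alpha> - N) * q_number q x * q_number q (N + 1 - x))
     - q powr (\<alpha> - N) * q_number q (x + 1) * q_number q (N - x)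
   = q * q_number q \<alpha> + q_number q (\<alpha> - N) - (1 + q) * q_number q (\<alpha> - x)"
proof -
  have "1 - q \<noteq> 0" using q by simp
  then show ?thesis
    using q q_powr_pos[of \<alpha>] q_powr_pos[of N] q_powr_pos[of x]
    by (simp add: q_number_def powr_add powr_diff divide_simps) algebra
qed

text \<open>Coefficient of \<open>e (n + 1)\<close> in the same relation, without the factor
  \<open>a n\<close>. With y = \<beta> - x and [-y] = -q^(-y) [y], the left side is q^(1-y) [y]
  ([y+1] - [y-1]), and the last bracket is q^(y-1) (1 + q).\<close>

lemma Z_V_upper_identity:
  "q_number q (x + 1 - \<beta>) * q_number q (\<beta> - x)
     - q * (q_number q (x - \<beta>) * q_number q (\<beta> - x + 1))
   = (1 + q) * q_number q (\<beta> - x)"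
proof -
  have "1 - q \<noteq> 0" using q by simp
  then show ?thesis
    using q q_powr_pos[of \<beta>] q_powr_pos[of x]
    by (simp add: q_number_def powr_add powr_diff divide_simps) algebra
qed

text \<open>Coefficient of \<open>e n\<close> in the relation for the q-commutator of
  \<open>X\<close> and \<open>V\<close>; it forces the value of \<xi>. The factor
  \<open>q_number q (\<beta> - x + 1)\<close> beside \<open>q_number q x\<close> comes from
  \<open>X\<close> raising \<open>e (n - 1)\<close>.\<close>

lemma X_V_diag_identity:
  "q * (q powr (\<alpha> - N) * q_number q (x + 1) * q_number q (N - x)) * q_number q (\<beta> - x)
     - (q powr (\<alpha> - N) * q_number q x * q_number q (N + 1 - x)) * q_number q (\<beta> - x + 1)
     + (q - 1) * q_number q (\<alpha> - x) * (q_number q (x - \<beta>) * q_number q (\<beta> - x + 1))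
   = q powr (\<alpha> + 1) * q_number q (- \<beta> - 1) * q_number q (\<beta> - N)
     - q_number q (x - \<beta>) * q_number q (\<beta> - x + 1)
     - q powr (\<alpha> - N) * q_number q x * q_number q (N + 1 - x)
     - q powr (\<alpha> - N) * q_number q (x + 1) * q_number q (N - x)"
proof -
  have "1 - q \<noteq> 0" using q by simp
  then show ?thesis
    using q q_powr_pos[of \<alpha>] q_powr_pos[of \<beta>] q_powr_pos[of N] q_powr_pos[of x]
    by (simp add: q_number_def powr_add powr_diff powr_minus divide_simps) algebra
qed

text \<open>Coefficient of \<open>e (n + 1)\<close> in that relation, without \<open>a n\<close>.
  With y = \<beta> - x, the last factors are q [y-1] and [y+1]; since [-y] = -q^(-y) [y], both sides
  equal -q^(1-y) [y-1] [y] [y+1].\<close>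

lemma X_V_upper_identity:
  "q_number q (x - \<beta>) * q_number q (\<beta> - x + 1) * (q_number q (\<beta> - x) - 1)
   = q_number q (x + 1 - \<beta>) * q_number q (\<beta> - x) * (1 + q * q_number q (\<beta> - x))"
proof -
  have "1 - q \<noteq> 0" using q by simp
  then show ?thesis
    using q q_powr_pos[of \<beta>] q_powr_pos[of x]
    by (simp add: q_number_def powr_add powr_diff divide_simps) algebra
qed

end

theorem proposition3p1:
  fixes q \<alpha> \<beta> :: real
    and N :: nat
    and a :: "int \<Rightarrow> real"
    and e :: "nat \<Rightarrow> 'v::real_vector"
    and X V Z :: "'v \<Rightarrow> 'v"
  assumes "q > 0" and "q \<noteq> 1"
    and "N > 0"
    and "\<And>i. 0 \<le> i \<Longrightarrow> i < int N \<Longrightarrow> a i \<noteq> 0"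
    and "a (- 1) = 0" and "a (int N) = 0"
    and "basis_upto N e"
    and "linear Z" and "linear X" and "linear V"
    and "\<And>n. n \<le> N \<Longrightarrow>
      Z (e n) = - e n + (if n < N then a (int n) *\<^sub>R e (n + 1) else 0)"
    and "\<And>n. n \<le> N \<Longrightarrow>
      X (e n) = - (q_number q (\<alpha> - real n) *\<^sub>R e n)
        + (if n < N then (a (int n) * q_number q (\<beta> - real n)) *\<^sub>R e (n + 1) else 0)"
    and "\<And>n. n \<le> N \<Longrightarrow>
      V (e n) = (q_number q (real n - \<beta>) * q_number q (\<beta> - real n + 1)) *\<^sub>R e n
        - (if n > 0
           then (q powr (\<alpha> - real N) * q_number q (real n) * q_number q (real N + 1 - real n)
                   / a (int n - 1)) *\<^sub>R e (n - 1)
           else 0)"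
  shows "meta_q_Hahn_representation q
           (q powr (\<alpha> + 1) * q_number q (- \<beta> - 1) * q_number q (\<beta> - real N))
           (q * q_number q \<alpha> + q_number q (\<alpha> - real N))
           X V Z"
proof -
  note q = assms(1,2) and aN = assms(6) and lin = assms(8-10)
  define x where "x n = q_number q (\<alpha> - real n)" for n :: nat
  define b where "b n = q_number q (\<beta> - real n)" for n :: nat
  define v where "v n = q_number q (real n - \<beta>) * q_number q (\<beta> - real n + 1)" for n :: nat
  \<comment> \<open>Lowering by \<open>g n\<close> and raising back by \<open>a (n - 1)\<close>
    multiplies to \<open>D n\<close>, so the scalar identities are free of \<open>a\<close>.\<close>
  define D where
    "D n = q powr (\<alpha> - real N) * q_number q (real n) * q_number q (real N + 1 - real n)" for n :: nat
  define g where "g n = D n / a (int n - 1)" for n :: nat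
  define \<xi> where "\<xi> = q powr (\<alpha> + 1) * q_number q (- \<beta> - 1) * q_number q (\<beta> - real N)"
  define \<eta> where "\<eta> = q * q_number q \<alpha> + q_number q (\<alpha> - real N)"

  have x_step: "x n = 1 + q * x (Suc n)" for n
    using q_number_plus_one[OF q, of "\<alpha> - real n - 1"] by (simp add: x_def algebra_simps)
  have b_step: "b n = 1 + q * b (Suc n)" for n
    using q_number_plus_one[OF q, of "\<beta> - real n - 1"] by (simp add: b_def algebra_simps)
  \<comment> \<open>Not written as \<open>b (n - 1)\<close>, because the subtraction on
    \<open>nat\<close> is truncated at \<open>n = 0\<close>.\<close>
  have b_pred: "q_number q (\<beta> - real n + 1) = 1 + q * b n" for n
    using q_number_plus_one[OF q] by (simp add: b_def)
  have v_Suc: "v (Suc n) = q_number q (real n + 1 - \<beta>) * b n" for n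
    by (simp add: v_def b_def algebra_simps)
  have D_Suc: "D (Suc n) = q powr (\<alpha> - real N) * q_number q (real n + 1) * q_number q (real N - real n)" for n
    by (simp add: D_def algebra_simps)
  have ZV_diag: "q * D n - D (Suc n) = \<eta> - (1 + q) * x n" for n
    using Z_V_diag_identity[OF q, of \<alpha> "real N" "real n"]
    by (simp add: D_Suc D_def[of n] \<eta>_def x_def)
  have ZV_upper: "v (Suc n) - q * v n = (1 + q) * b n" for n
    using Z_V_upper_identity[OF q, of "real n" \<beta>] by (simp add: v_Suc v_def[of n] b_def)
  have XV_diag: "q * D (Suc n) * b n - D n * (1 + q * b n) + (q - 1) * x n * v n
      = \<xi> - v n - D n - D (Suc n)" for n
    using X_V_diag_identity[OF q, of \<alpha> "real N" "real n" \<beta>]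
    unfolding b_pred[symmetric] by (simp add: D_Suc D_def[of n] \<xi>_def x_def b_def v_def[of n])
  have XV_upper: "v n * (b n - 1) = v (Suc n) * (1 + q * b n)" for n
    using X_V_upper_identity[OF q, of "real n" \<beta>] by (simp add: v_Suc v_def[of n] b_def)

  \<comment> \<open>Since \<open>a N = 0\<close> and \<open>D 0 = D (N + 1) = 0\<close>, the formulas below also hold at \<open>n = 0\<close> and
    \<open>n = N\<close>, where the vectors \<open>e (0 - 1) = e 0\<close>, \<open>e (N + 1)\<close> and \<open>e (N + 2)\<close> are junk.\<close>
  have Z: "Z (e n) = a (int n) *\<^sub>R e (Suc n) - e n" if "n \<le> N" for n
    using assms(11)[OF that] that aN by (cases "n = N") auto
  have X: "X (e n) = (a (int n) * b n) *\<^sub>R e (Suc n) - x n *\<^sub>R e n" if "n \<le> N" for n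
    using assms(12)[OF that] that aN by (cases "n = N") (auto simp: b_def x_def)
  have V: "V (e n) = v n *\<^sub>R e n - g n *\<^sub>R e (n - 1)" if "n \<le> N" for n
    using assms(13)[OF that] q
    by (cases "n = 0") (simp_all add: v_def g_def D_def)

  \<comment> \<open>The common factor \<open>a n\<close> has to stay: for \<open>n = N\<close>
    nothing is known about \<open>Z (e (N + 1))\<close>, but the factor is zero there.\<close>
  have aZ: "a (int n) *\<^sub>R Z (e (Suc n))
      = a (int n) *\<^sub>R (a (int n + 1) *\<^sub>R e (Suc (Suc n)) - e (Suc n))" if "n \<le> N" for n
    using Z[of "Suc n"] that aN by (cases "n = N") (auto simp: add.commute)
  have aX: "a (int n) *\<^sub>R X (e (Suc n))
      = a (int n) *\<^sub>R ((a (int n + 1) * b (Suc n)) *\<^sub>R e (Suc (Suc n)) - x (Suc n) *\<^sub>R e (Suc n))"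
    if "n \<le> N" for n
    using X[of "Suc n"] that aN by (cases "n = N") (auto simp: add.commute)
  \<comment> \<open>For \<open>n = N\<close> this needs \<open>D (N + 1) = 0\<close> besides
    \<open>a N = 0\<close>, since \<open>D\<close> has no factor \<open>a\<close>.\<close>
  have aV: "a (int n) *\<^sub>R V (e (Suc n)) = (a (int n) * v (Suc n)) *\<^sub>R e (Suc n) - D (Suc n) *\<^sub>R e n"
    if "n \<le> N" for n
  proof (cases "n = N")
    case True
    then show ?thesis using aN q by (simp add: D_def)
  next
    case False
    then have "a (int n) * g (Suc n) = D (Suc n)"
      using assms(4)[of "int n"] that by (simp add: g_def)
    then show ?thesis
      using V[of "Suc n"] False that by (simp add: scaleR_diff_right)
  qed
  \<comment> \<open>At \<open>n = 0\<close> both sides vanish by \<open>D 0 = 0\<close>. In the same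
    way \<open>g 0 = 0\<close> hides the truncated vector \<open>e (0 - 1)\<close> in the next two
    facts.\<close>
  have ga: "g n * a (int n - 1) = D n" if "n \<le> N" for n
    using assms(4)[of "int n - 1"] that q by (cases "n = 0") (auto simp: g_def D_def)
  have gZ: "g n *\<^sub>R Z (e (n - 1)) = D n *\<^sub>R e n - g n *\<^sub>R e (n - 1)" if "n \<le> N" for n
    using Z[of "n - 1"] ga[OF that] that q
    by (cases "n = 0") (auto simp: g_def D_def scaleR_diff_right of_nat_diff)
  have gX: "g n *\<^sub>R X (e (n - 1))
      = (D n * (1 + q * b n)) *\<^sub>R e n - (g n * (1 + q * x n)) *\<^sub>R e (n - 1)" if "n \<le> N" for n
  proof (cases "n = 0")
    case True
    then show ?thesis using q by (simp add: g_def D_def)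
  next
    case False
    then have "b (n - 1) = 1 + q * b n" "x (n - 1) = 1 + q * x n"
      using b_step[of "n - 1"] x_step[of "n - 1"] by simp_all
    then show ?thesis
      using X[of "n - 1"] ga[OF that] that False
      by (simp add: scaleR_diff_right of_nat_diff flip: mult.assoc)
  qed

  note lins = linear_diff[OF lin(1)] linear_diff[OF lin(2)] linear_diff[OF lin(3)]
    linear_scale[OF lin(1)] linear_scale[OF lin(2)] linear_scale[OF lin(3)]
  have ZX_e: "Z (X (e n)) - q *\<^sub>R X (Z (e n)) = Z (Z (e n)) + Z (e n) - (1 - q) *\<^sub>R X (e n)"
    if n: "n \<le> N" for n
  proof -
    have XZ: "X (Z (e n)) = a (int n) *\<^sub>R X (e (Suc n)) - X (e n)"
      by (simp only: Z[OF n] lins)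
    have ZX: "Z (X (e n)) = b n *\<^sub>R (a (int n) *\<^sub>R Z (e (Suc n))) - x n *\<^sub>R Z (e n)"
      by (simp add: X[OF n] lins mult.commute)
    have ZZ: "Z (Z (e n)) = a (int n) *\<^sub>R Z (e (Suc n)) - Z (e n)"
      by (simp only: Z[OF n] lins)
    \<comment> \<open>The coefficients of \<open>e (n + 2)\<close> match by \<open>b_step\<close>,
      those of \<open>e (n + 1)\<close> by \<open>x_step\<close>; those of \<open>e n\<close> agree
      outright.\<close>
    show ?thesis
      unfolding XZ ZX ZZ unfolding aX[OF n] aZ[OF n] X[OF n] Z[OF n] x_step[of n] b_step[of n]
      by (simp add: algebra_simps)
  qed
  have VX_e: "X (V (e n)) - q *\<^sub>R V (X (e n)) = V (Z (e n)) + Z (V (e n)) + V (e n) + \<xi> *\<^sub>R e n"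
    if n: "n \<le> N" for n
  proof -
    have XV: "X (V (e n)) = v n *\<^sub>R X (e n) - g n *\<^sub>R X (e (n - 1))"
      by (simp only: V[OF n] lins)
    have VX: "V (X (e n)) = b n *\<^sub>R (a (int n) *\<^sub>R V (e (Suc n))) - x n *\<^sub>R V (e n)"
      by (simp add: X[OF n] lins mult.commute)
    have ZV: "Z (V (e n)) = v n *\<^sub>R Z (e n) - g n *\<^sub>R Z (e (n - 1))"
      by (simp only: V[OF n] lins)
    have VZ: "V (Z (e n)) = a (int n) *\<^sub>R V (e (Suc n)) - V (e n)"
      by (simp only: Z[OF n] lins)
    \<comment> \<open>The lowering coefficient is
      \<open>g n * (1 + q * x n) - q * x n * g n\<close>, which is \<open>g n\<close>, so
      \<open>e (n - 1)\<close> requires no further identity.\<close>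
    have "X (V (e n)) - q *\<^sub>R V (X (e n))
      = (q * D (Suc n) * b n - D n * (1 + q * b n) + (q - 1) * x n * v n) *\<^sub>R e n
        + (a (int n) * (v n * b n - q * b n * v (Suc n))) *\<^sub>R e (Suc n) + g n *\<^sub>R e (n - 1)"
      unfolding XV VX unfolding aV[OF n] gX[OF n] X[OF n] V[OF n] by (simp add: algebra_simps)
    also have "v n * b n - q * b n * v (Suc n) = v n + v (Suc n)"
      using XV_upper[of n] by (simp add: algebra_simps)
    also have "(q * D (Suc n) * b n - D n * (1 + q * b n) + (q - 1) * x n * v n) *\<^sub>R e n
        + (a (int n) * (v n + v (Suc n))) *\<^sub>R e (Suc n) + g n *\<^sub>R e (n - 1)
      = V (Z (e n)) + Z (V (e n)) + V (e n) + \<xi> *\<^sub>R e n"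
      unfolding XV_diag ZV VZ unfolding aV[OF n] gZ[OF n] Z[OF n] V[OF n] by (simp add: algebra_simps)
    finally show ?thesis .
  qed
  have VZ_e: "V (Z (e n)) - q *\<^sub>R Z (V (e n)) = (1 + q) *\<^sub>R X (e n) - (1 - q) *\<^sub>R V (e n) + \<eta> *\<^sub>R e n"
    if n: "n \<le> N" for n
  proof -
    have ZV: "Z (V (e n)) = v n *\<^sub>R Z (e n) - g n *\<^sub>R Z (e (n - 1))"
      by (simp only: V[OF n] lins)
    have VZ: "V (Z (e n)) = a (int n) *\<^sub>R V (e (Suc n)) - V (e n)"
      by (simp only: Z[OF n] lins)
    have "V (Z (e n)) - q *\<^sub>R Z (V (e n))
      = (q * D n - D (Suc n) - (1 - q) * v n) *\<^sub>R e n
        + (a (int n) * (v (Suc n) - q * v n)) *\<^sub>R e (Suc n) + ((1 - q) * g n) *\<^sub>R e (n - 1)"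
      unfolding ZV VZ unfolding aV[OF n] gZ[OF n] Z[OF n] V[OF n] by (simp add: algebra_simps)
    also have "\<dots> = (1 + q) *\<^sub>R X (e n) - (1 - q) *\<^sub>R V (e n) + \<eta> *\<^sub>R e n"
      unfolding ZV_diag ZV_upper X[OF n] V[OF n] by (simp add: algebra_simps)
    finally show ?thesis .
  qed

  have span: "u \<in> span (e ` {0..N})" for u
    using assms(7) by (simp add: basis_upto_def)
  have ext: "F = G" if "linear F" "linear G" "\<And>n. n \<le> N \<Longrightarrow> F (e n) = G (e n)" for F G :: "'v \<Rightarrow> 'v"
    using linear_eq_on_span[OF that(1,2) _ span] that(3) by fastforce
  note comp = linear_compose[unfolded o_def]
  note lin_intros = linear_compose_add linear_compose_sub linear_compose_scale_right
    comp[OF lin(1) lin(2)] comp[OF lin(2) lin(1)] comp[OF lin(1) lin(3)] comp[OF lin(3) lin(1)]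
    comp[OF lin(2) lin(3)] comp[OF lin(3) lin(2)] comp[OF lin(1) lin(1)] lin linear_ident
  \<comment> \<open>Both sides of each relation are linear in \<open>u\<close>, so
    \<open>ext\<close> leaves only the values on the basis computed above.\<close>
  have "(\<lambda>u. Z (X u) - q *\<^sub>R X (Z u)) = (\<lambda>u. Z (Z u) + Z u - (1 - q) *\<^sub>R X u)"
    by (rule ext) (intro lin_intros | erule ZX_e)+
  moreover have "(\<lambda>u. X (V u) - q *\<^sub>R V (X u)) = (\<lambda>u. V (Z u) + Z (V u) + V u + \<xi> *\<^sub>R u)"
    by (rule ext) (intro lin_intros | erule VX_e)+
  moreover have "(\<lambda>u. V (Z u) - q *\<^sub>R Z (V u)) = (\<lambda>u. (1 + q) *\<^sub>R X u - (1 - q) *\<^sub>R V u + \<eta> *\<^sub>R u)"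
    by (rule ext) (intro lin_intros | erule VZ_e)+
  ultimately show ?thesis
    unfolding \<xi>_def[symmetric] \<eta>_def[symmetric] meta_q_Hahn_representation_def
      q_commutator_def anticommutator_def
    using lin by (simp add: numeral_2_eq_2)
qed

end
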